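(* Let $\mathbb{A}$ be a finite category. Write $\widetilde{\mathbb{A}}$ for the category obtained from $\mathbb{A}$ by freely adjoining an initial object $0$ and a terminal object $1$. If $\mathbb{A}$ has Möbius inversion then $\widetilde{\mathbb{A}}$ does too, and $$\mu_{\widetilde{\mathbb{A}}}(0, 1) = \chi(\mathbb{A}) - 1.$$
   Context: Freely adjoining $0$ and $1$ means: $\widetilde{\mathbb{A}}$ contains $\mathbb{A}$ as a full subcategory, has two further objects $0$ and $1$, exactly one arrow from $0$ to each object, exactly one arrow from each object to $1$, no arrows from an object of $\mathbb{A}$ or from $1$ to $0$, and no arrows from $1$ to an object of $\mathbb{A}$. For a finite category $\mathbb{A}$, let $R(\mathbb{A})$ be the $\mathbb{Q}$-algebra of functions $\mathrm{ob}\,\mathbb{A} \times \mathrm{ob}\,\mathbb{A} \to \mathbb{Q}$ with pointwise addition and scalar multiplication, multiplication $(\theta\phi)(a,c) = \sum_{b} \theta(a,b)\phi(b,c)$, and unit the Kronecker $\delta$. The zeta function $\zeta_{\mathbb{A}} \in R(\mathbb{A})$ is $\zeta_{\mathbb{A}}(a,b) = |\mathbb{A}(a,b)|$. The category $\mathbb{A}$ has Möbius inversion if $\zeta_{\mathbb{A}}$ is invertible in $R(\mathbb{A})$; its inverse $\mu_{\mathbb{A}}$ is the Möbius function of $\mathbb{A}$. A weighting on a finite category $\mathbb{A}$ is a function $k^\bullet: \mathrm{ob}\,\mathbb{A} \to \mathbb{Q}$ such that $\sum_{b} |\mathbb{A}(a,b)|\, k^b = 1$ for all $a$; a coweighting $k_\bullet$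 is a weighting on $\mathbb{A}^{\mathrm{op}}$. If $\mathbb{A}$ admits both, its Euler characteristic is $\chi(\mathbb{A}) = \sum_a k^a = \sum_a k_a$ (independent of choices). If $\mathbb{A}$ has Möbius inversion then it has Euler characteristic and $\chi(\mathbb{A}) = \sum_{a,b} \mu_{\mathbb{A}}(a,b)$. *)

theory Defs
  imports Complex_Main "HOL-Library.FuncSet" "HOL-Algebra.Module"
begin

section \<open>Finite categories\<close>

text \<open>
  A category is given by a set of objects and a family of hom-sets.  The hom-sets are not
  required to be disjoint, so composition also takes the three objects involved:
  \<^term>\<open>Comp A a b c g f\<close> is the composite of \<open>f : a \<rightarrow> b\<close> followed by \<open>g : b \<rightarrow> c\<close>.
\<close>

record ('o, 'm) cat =
  Ob :: "'o set"
  Hom :: "'o \<Rightarrow> 'o \<Rightarrow> 'm set"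
  Id :: "'o \<Rightarrow> 'm"
  Comp :: "'o \<Rightarrow> 'o \<Rightarrow> 'o \<Rightarrow> 'm \<Rightarrow> 'm \<Rightarrow> 'm"

locale category =
  fixes A :: "('o, 'm) cat"
  assumes Id_in_Hom: "a \<in> Ob A \<Longrightarrow> Id A a \<in> Hom A a a"
    and Comp_in_Hom:
      "\<lbrakk>a \<in> Ob A; b \<in> Ob A; c \<in> Ob A; f \<in> Hom A a b; g \<in> Hom A b c\<rbrakk>
        \<Longrightarrow> Comp A a b c g f \<in> Hom A a c"
    and Comp_Id_left:
      "\<lbrakk>a \<in> Ob A; b \<in> Ob A; f \<in> Hom A a b\<rbrakk> \<Longrightarrow> Comp A a b b (Id A b) f = f"
    and Comp_Id_right:
      "\<lbrakk>a \<in> Ob A; b \<in> Ob A; f \<in> Hom A a b\<rbrakk> \<Longrightarrow> Comp A a a b f (Id A a) = f"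
    and Comp_assoc:
      "\<lbrakk>a \<in> Ob A; b \<in> Ob A; c \<in> Ob A; d \<in> Ob A;
        f \<in> Hom A a b; g \<in> Hom A b c; h \<in> Hom A c d\<rbrakk>
        \<Longrightarrow> Comp A a c d h (Comp A a b c g f) = Comp A a b d (Comp A b c d h g) f"

locale finite_category = category A for A :: "('o, 'm) cat" +
  assumes finite_Ob: "finite (Ob A)"
    and finite_Hom: "\<lbrakk>a \<in> Ob A; b \<in> Ob A\<rbrakk> \<Longrightarrow> finite (Hom A a b)"

definition op_cat :: "('o, 'm) cat \<Rightarrow> ('o, 'm) cat" where
  "op_cat A =
    \<lparr>Ob = Ob A, Hom = (\<lambda>a b. Hom A b a), Id = Id A, Comp = (\<lambda>a b c g f. Comp A c b a f g)\<rparr>"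

lemma category_op_cat: "category A \<Longrightarrow> category (op_cat A)"
  unfolding category_def op_cat_def by simp

lemma finite_category_op_cat: "finite_category A \<Longrightarrow> finite_category (op_cat A)"
  unfolding finite_category_def finite_category_axioms_def
  by (simp add: category_op_cat) (simp add: op_cat_def)


section \<open>Freely adjoining an initial and a terminal object\<close>

datatype 'o adjoined = Initial | Base 'o | Terminal

text \<open>
  An old arrow \<open>f\<close> becomes \<^term>\<open>Some f\<close>; \<^term>\<open>None\<close> is the unique arrow in every hom-set
  out of \<^term>\<open>Initial\<close> or into \<^term>\<open>Terminal\<close>.
\<close>

fun adjoin_Hom ::
    "('o, 'm) cat \<Rightarrow> 'o adjoined \<Rightarrow> 'o adjoined \<Rightarrow> 'm option set" where
  "adjoin_Hom A Initial y = {None}"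
| "adjoin_Hom A (Base a) Initial = {}"
| "adjoin_Hom A (Base a) (Base b) = Some ` Hom A a b"
| "adjoin_Hom A (Base a) Terminal = {None}"
| "adjoin_Hom A Terminal Initial = {}"
| "adjoin_Hom A Terminal (Base b) = {}"
| "adjoin_Hom A Terminal Terminal = {None}"

fun adjoin_Id :: "('o, 'm) cat \<Rightarrow> 'o adjoined \<Rightarrow> 'm option" where
  "adjoin_Id A (Base a) = Some (Id A a)"
| "adjoin_Id A Initial = None"
| "adjoin_Id A Terminal = None"

fun adjoin_Comp ::
    "('o, 'm) cat \<Rightarrow> 'o adjoined \<Rightarrow> 'o adjoined \<Rightarrow> 'o adjoined
      \<Rightarrow> 'm option \<Rightarrow> 'm option \<Rightarrow> 'm option" where
  "adjoin_Comp A (Base a) (Base b) (Base c) (Some g) (Some f) = Some (Comp A a b c g f)"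
| "adjoin_Comp A _ _ _ _ _ = None"

definition adjoin :: "('o, 'm) cat \<Rightarrow> ('o adjoined, 'm option) cat" where
  "adjoin A =
    \<lparr>Ob = insert Initial (insert Terminal (Base ` Ob A)),
     Hom = adjoin_Hom A, Id = adjoin_Id A, Comp = adjoin_Comp A\<rparr>"

lemma Ob_adjoin: "Ob (adjoin A) = {Initial, Terminal} \<union> Base ` Ob A"
  by (auto simp: adjoin_def)

lemma adjoin_initial: "\<exists>!f. f \<in> Hom (adjoin A) Initial y"
  by (simp add: adjoin_def)

lemma adjoin_terminal: "\<exists>!f. f \<in> Hom (adjoin A) x Terminal"
  by (cases x) (simp_all add: adjoin_def)

lemma adjoin_empty_Homs:
  "Hom (adjoin A) (Base a) Initial = {}"
  "Hom (adjoin A) Terminal Initial = {}"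
  "Hom (adjoin A) Terminal (Base a) = {}"
  by (simp_all add: adjoin_def)

lemma adjoin_full_subcategory:
  "inj Base"
  "bij_betw Some (Hom A a b) (Hom (adjoin A) (Base a) (Base b))"
  "Id (adjoin A) (Base a) = Some (Id A a)"
  "Comp (adjoin A) (Base a) (Base b) (Base c) (Some g) (Some f) = Some (Comp A a b c g f)"
  by (auto simp: adjoin_def inj_on_def bij_betw_def)

lemma category_adjoin:
  assumes "category A"
  shows "category (adjoin A)"
proof -
  interpret category A by fact
  show ?thesis
  proof
    fix x y assume "x \<in> Ob (adjoin A)"
    then show "Id (adjoin A) x \<in> Hom (adjoin A) x x"
      by (auto simp: adjoin_def Id_in_Hom)
  next
    fix x y z f g
    assume "x \<in> Ob (adjoin A)" "y \<in> Ob (adjoin A)" "z \<in> Ob (adjoin A)"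
      "f \<in> Hom (adjoin A) x y" "g \<in> Hom (adjoin A) y z"
    then show "Comp (adjoin A) x y z g f \<in> Hom (adjoin A) x z"
      by (auto simp: adjoin_def intro!: imageI Comp_in_Hom)
  next
    fix x y f
    assume "x \<in> Ob (adjoin A)" "y \<in> Ob (adjoin A)" "f \<in> Hom (adjoin A) x y"
    then show "Comp (adjoin A) x y y (Id (adjoin A) y) f = f"
      by (auto simp: adjoin_def Comp_Id_left)
  next
    fix x y f
    assume "x \<in> Ob (adjoin A)" "y \<in> Ob (adjoin A)" "f \<in> Hom (adjoin A) x y"
    then show "Comp (adjoin A) x x y f (Id (adjoin A) x) = f"
      by (auto simp: adjoin_def Comp_Id_right)
  next
    fix w x y z f g h
    assume "w \<in> Ob (adjoin A)" "x \<in> Ob (adjoin A)" "y \<in> Ob (adjoin A)" "z \<in> Ob (adjoin A)"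
      "f \<in> Hom (adjoin A) w x" "g \<in> Hom (adjoin A) x y" "h \<in> Hom (adjoin A) y z"
    then show "Comp (adjoin A) w y z h (Comp (adjoin A) w x y g f) =
        Comp (adjoin A) w x z (Comp (adjoin A) x y z h g) f"
      by (auto simp: adjoin_def Comp_assoc)
  qed
qed

lemma finite_category_adjoin:
  assumes "finite_category A"
  shows "finite_category (adjoin A)"
proof -
  interpret finite_category A by fact
  show ?thesis
  proof (intro finite_category.intro finite_category_axioms.intro category_adjoin)
    show "category A" ..
    show "finite (Ob (adjoin A))" by (simp add: adjoin_def finite_Ob)
    show "finite (Hom (adjoin A) x y)" if "x \<in> Ob (adjoin A)" "y \<in> Ob (adjoin A)" for x y
      using that by (auto simp: adjoin_def finite_Hom)
  qed
qed


section \<open>Moebius inversion\<close>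

text \<open>
  Functions on \<open>ob A \<times> ob A\<close> are represented as extensional functions, so that equality in
  the algebra is equality of functions.
\<close>

definition RA :: "('o, 'm) cat \<Rightarrow> (rat, 'o \<times> 'o \<Rightarrow> rat) module" where
  "RA A =
    \<lparr>carrier = Ob A \<times> Ob A \<rightarrow>\<^sub>E UNIV,
     mult = (\<lambda>\<theta> \<phi>. \<lambda>(a, c) \<in> Ob A \<times> Ob A. \<Sum>b\<in>Ob A. \<theta> (a, b) * \<phi> (b, c)),
     one = (\<lambda>(a, b) \<in> Ob A \<times> Ob A. if a = b then 1 else 0),
     zero = (\<lambda>_ \<in> Ob A \<times> Ob A. 0),
     add = (\<lambda>\<theta> \<phi>. \<lambda>p \<in> Ob A \<times> Ob A. \<theta> p + \<phi> p),
     smult = (\<lambda>q \<theta>. \<lambda>p \<in> Ob A \<times> Ob A. q * \<theta> p)\<rparr>"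

definition zeta :: "('o, 'm) cat \<Rightarrow> 'o \<times> 'o \<Rightarrow> rat" where
  "zeta A = (\<lambda>(a, b) \<in> Ob A \<times> Ob A. of_nat (card (Hom A a b)))"

definition has_Moebius_inversion :: "('o, 'm) cat \<Rightarrow> bool" where
  "has_Moebius_inversion A \<longleftrightarrow> zeta A \<in> Units (RA A)"

definition moebius :: "('o, 'm) cat \<Rightarrow> 'o \<times> 'o \<Rightarrow> rat" where
  "moebius A = inv\<^bsub>RA A\<^esub> (zeta A)"

lemma mult_RA:
  "\<theta> \<otimes>\<^bsub>RA A\<^esub> \<phi> =
    (\<lambda>(a, c) \<in> Ob A \<times> Ob A. \<Sum>b\<in>Ob A. \<theta> (a, b) * \<phi> (b, c))"
  by (simp add: RA_def)

lemma one_RA: "\<one>\<^bsub>RA A\<^esub> = (\<lambda>(a, b) \<in> Ob A \<times> Ob A. if a = b then 1 else 0)"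
  by (simp add: RA_def)

lemma ring_RA:
  fixes A :: "('a, 'b) cat"
  assumes "finite (Ob A)"
  shows "ring (RA A)"
proof (rule ringI)
  show "abelian_group (RA A)"
  proof (rule abelian_groupI)
    fix \<theta> assume \<theta>: "\<theta> \<in> carrier (RA A)"
    show "\<exists>\<phi>\<in>carrier (RA A). \<phi> \<oplus>\<^bsub>RA A\<^esub> \<theta> = \<zero>\<^bsub>RA A\<^esub>"
      by (rule bexI[of _ "\<lambda>p \<in> Ob A \<times> Ob A. - \<theta> p"]) (auto simp: RA_def fun_eq_iff)
  qed (auto simp: RA_def fun_eq_iff PiE_def extensional_def)
  show "monoid (RA A)"
  proof (rule monoidI)
    fix \<theta> \<phi> \<psi> :: "'a \<times> 'a \<Rightarrow> rat"
    have "(\<Sum>c\<in>Ob A. (\<Sum>b\<in>Ob A. \<theta> (a, b) * \<phi> (b, c)) * \<psi> (c, d)) =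
        (\<Sum>b\<in>Ob A. \<theta> (a, b) * (\<Sum>c\<in>Ob A. \<phi> (b, c) * \<psi> (c, d)))" for a d
    proof -
      have "(\<Sum>c\<in>Ob A. (\<Sum>b\<in>Ob A. \<theta> (a, b) * \<phi> (b, c)) * \<psi> (c, d)) =
          (\<Sum>c\<in>Ob A. \<Sum>b\<in>Ob A. \<theta> (a, b) * (\<phi> (b, c) * \<psi> (c, d)))"
        by (simp add: sum_distrib_right mult.assoc)
      also have "\<dots> = (\<Sum>b\<in>Ob A. \<Sum>c\<in>Ob A. \<theta> (a, b) * (\<phi> (b, c) * \<psi> (c, d)))"
        by (rule sum.swap)
      finally show ?thesis by (simp add: sum_distrib_left)
    qed
    then show "\<theta> \<otimes>\<^bsub>RA A\<^esub> \<phi> \<otimes>\<^bsub>RA A\<^esub> \<psi> = \<theta> \<otimes>\<^bsub>RA A\<^esub> (\<phi> \<otimes>\<^bsub>RA A\<^esub> \<psi>)"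
      by (auto simp: RA_def fun_eq_iff restrict_def)
  qed (auto simp: RA_def fun_eq_iff restrict_def PiE_def extensional_def assms
      if_distrib[of "\<lambda>x. x * _"] if_distrib[of "\<lambda>x. _ * x"] sum.delta sum.delta' cong: if_cong)
qed (auto simp: RA_def fun_eq_iff restrict_def PiE_def extensional_def
    distrib_left distrib_right sum.distrib)


section \<open>Euler characteristic\<close>

definition weighting :: "('o, 'm) cat \<Rightarrow> ('o \<Rightarrow> rat) \<Rightarrow> bool" where
  "weighting A k \<longleftrightarrow> (\<forall>a\<in>Ob A. (\<Sum>b\<in>Ob A. of_nat (card (Hom A a b)) * k b) = 1)"

definition coweighting :: "('o, 'm) cat \<Rightarrow> ('o \<Rightarrow> rat) \<Rightarrow> bool" where
  "coweighting A k \<longleftrightarrow> weighting (op_cat A) k"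

definition has_Euler_char :: "('o, 'm) cat \<Rightarrow> bool" where
  "has_Euler_char A \<longleftrightarrow> (\<exists>k. weighting A k) \<and> (\<exists>k. coweighting A k)"

text \<open>Meaningful only for categories satisfying \<^const>\<open>has_Euler_char\<close>.\<close>

definition Euler_char :: "('o, 'm) cat \<Rightarrow> rat" where
  "Euler_char A = (THE x. (\<exists>k. weighting A k \<and> x = (\<Sum>a\<in>Ob A. k a)) \<and>
                          (\<exists>k. coweighting A k \<and> x = (\<Sum>a\<in>Ob A. k a)))"

lemma sum_weighting_eq_sum_coweighting:
  assumes "weighting A k" "coweighting A l"
  shows "(\<Sum>a\<in>Ob A. k a) = (\<Sum>a\<in>Ob A. l a)"
proof -
  let ?z = "\<lambda>a b. of_nat (card (Hom A a b)) :: rat"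
  have l: "(\<Sum>a\<in>Ob A. ?z a b * l a) = 1" if "b \<in> Ob A" for b
    using assms(2) that by (simp add: coweighting_def weighting_def op_cat_def)
  have k: "(\<Sum>b\<in>Ob A. ?z a b * k b) = 1" if "a \<in> Ob A" for a
    using assms(1) that by (simp add: weighting_def)
  have "(\<Sum>b\<in>Ob A. k b) = (\<Sum>b\<in>Ob A. (\<Sum>a\<in>Ob A. ?z a b * l a) * k b)"
    by (rule sum.cong) (simp_all add: l)
  also have "\<dots> = (\<Sum>b\<in>Ob A. \<Sum>a\<in>Ob A. l a * (?z a b * k b))"
    by (simp add: sum_distrib_left sum_distrib_right mult_ac)
  also have "\<dots> = (\<Sum>a\<in>Ob A. \<Sum>b\<in>Ob A. l a * (?z a b * k b))"
    by (rule sum.swap)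
  also have "\<dots> = (\<Sum>a\<in>Ob A. l a * (\<Sum>b\<in>Ob A. ?z a b * k b))"
    by (simp add: sum_distrib_left)
  also have "\<dots> = (\<Sum>a\<in>Ob A. l a)"
    by (rule sum.cong) (simp_all add: k)
  finally show ?thesis .
qed

lemma Euler_char_eq:
  assumes "has_Euler_char A"
  shows "weighting A k \<Longrightarrow> Euler_char A = (\<Sum>a\<in>Ob A. k a)"
    and "coweighting A l \<Longrightarrow> Euler_char A = (\<Sum>a\<in>Ob A. l a)"
proof -
  obtain k0 l0 where kl: "weighting A k0" "coweighting A l0"
    using assms by (auto simp: has_Euler_char_def)
  have *: "Euler_char A = (\<Sum>a\<in>Ob A. k0 a)"
    unfolding Euler_char_def
    using kl sum_weighting_eq_sum_coweighting[OF kl]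
    by (intro the_equality) (auto dest: sum_weighting_eq_sum_coweighting[OF _ kl(2)])
  show "Euler_char A = (\<Sum>a\<in>Ob A. k a)" if "weighting A k"
    using * sum_weighting_eq_sum_coweighting[OF kl]
      sum_weighting_eq_sum_coweighting[OF that kl(2)] by simp
  show "Euler_char A = (\<Sum>a\<in>Ob A. l a)" if "coweighting A l"
    using * sum_weighting_eq_sum_coweighting[OF kl(1) that] by simp
qed

lemma Moebius_inversion_imp_Euler_char:
  assumes "finite (Ob A)" "has_Moebius_inversion A"
  shows "has_Euler_char A"
    and "Euler_char A = (\<Sum>a\<in>Ob A. \<Sum>b\<in>Ob A. moebius A (a, b))"
proof -
  interpret ring "RA A" using assms(1) by (rule ring_RA)
  have z: "zeta A \<in> Units (RA A)"
    using assms(2) by (simp add: has_Moebius_inversion_def)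
  let ?k = "\<lambda>a. \<Sum>b\<in>Ob A. moebius A (a, b)"
  let ?l = "\<lambda>b. \<Sum>a\<in>Ob A. moebius A (a, b)"
  have zm: "(\<Sum>b\<in>Ob A. of_nat (card (Hom A a b)) * moebius A (b, c)) = (if a = c then 1 else 0)"
    if "a \<in> Ob A" "c \<in> Ob A" for a c
    using fun_cong[OF Units_r_inv[OF z], of "(a, c)"] that
    by (simp add: mult_RA one_RA moebius_def zeta_def)
  have mz: "(\<Sum>b\<in>Ob A. moebius A (a, b) * of_nat (card (Hom A b c))) = (if a = c then 1 else 0)"
    if "a \<in> Ob A" "c \<in> Ob A" for a c
    using fun_cong[OF Units_l_inv[OF z], of "(a, c)"] that
    by (simp add: mult_RA one_RA moebius_def zeta_def)
  have k: "weighting A ?k"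
    unfolding weighting_def
  proof
    fix a assume a: "a \<in> Ob A"
    have "(\<Sum>b\<in>Ob A. of_nat (card (Hom A a b)) * ?k b) =
        (\<Sum>c\<in>Ob A. \<Sum>b\<in>Ob A. of_nat (card (Hom A a b)) * moebius A (b, c))"
      unfolding sum_distrib_left by (rule sum.swap)
    also have "\<dots> = (\<Sum>c\<in>Ob A. if a = c then 1 else 0)"
      by (rule sum.cong) (simp_all add: zm a)
    finally show "(\<Sum>b\<in>Ob A. of_nat (card (Hom A a b)) * ?k b) = 1"
      using a assms(1) by simp
  qed
  have l: "coweighting A ?l"
    unfolding coweighting_def weighting_def
  proof
    fix c assume "c \<in> Ob (op_cat A)"
    then have c: "c \<in> Ob A" by (simp add: op_cat_def)
    have "(\<Sum>b\<in>Ob A. of_nat (card (Hom A b c)) * ?l b) =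
        (\<Sum>a\<in>Ob A. \<Sum>b\<in>Ob A. moebius A (a, b) * of_nat (card (Hom A b c)))"
      unfolding sum_distrib_left by (subst sum.swap) (simp add: mult.commute)
    also have "\<dots> = (\<Sum>a\<in>Ob A. if a = c then 1 else 0)"
      by (rule sum.cong) (simp_all add: mz c)
    finally show "(\<Sum>b\<in>Ob (op_cat A). of_nat (card (Hom (op_cat A) c b)) * ?l b) = 1"
      using c assms(1) by (simp add: op_cat_def)
  qed
  show "has_Euler_char A" using k l by (auto simp: has_Euler_char_def)
  then show "Euler_char A = (\<Sum>a\<in>Ob A. \<Sum>b\<in>Ob A. moebius A (a, b))"
    using k by (rule Euler_char_eq(1))
qed

end

theory Submission
  imports Defs
begin

text \<open>
  List the objects of the enlarged category as the initial object, then the objects of \<open>A\<close>, then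
  the terminal object.  Its zeta function is then the block upper triangular matrix below, with the
  zeta matrix \<open>Z\<close> of \<open>A\<close> in the middle and a border of ones; \<open>u\<close> is the column vector of ones.

    \<open>1  u\<^sup>T  1\<close>
    \<open>0  Z   u\<close>
    \<open>0  0   1\<close>

  If \<open>Z\<close> has inverse \<open>M\<close>, back substitution inverts this matrix; the inverse is

    \<open>1  -u\<^sup>T M  u\<^sup>T M u - 1\<close>
    \<open>0   M     -M u\<close>
    \<open>0   0      1\<close>

  The vector \<open>M u\<close> of row sums of \<open>M\<close> is a weighting on \<open>A\<close> and \<open>u\<^sup>T M\<close> is a coweighting, which
  is what makes the borders cancel in the products
  (\<open>row_sums_moebius_weighting\<close>, \<open>column_sums_moebius_coweighting\<close>).  The corner entry is the sum
  of all entries of \<open>M\<close> minus one, and that sum is the Euler characteristic of \<open>A\<close>.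
\<close>

text \<open>
  Two families of equations between rational numbers characterise the inverse in the algebra;
  extensionality of its elements is dealt with here once and for all.
\<close>
lemma moebius_eqI:
  assumes "finite (Ob A)"
    and "\<nu> \<in> extensional (Ob A \<times> Ob A)"
    and "\<And>a c. \<lbrakk>a \<in> Ob A; c \<in> Ob A\<rbrakk> \<Longrightarrow>
      (\<Sum>b\<in>Ob A. of_nat (card (Hom A a b)) * \<nu> (b, c)) = (if a = c then 1 else 0)"
    and "\<And>a c. \<lbrakk>a \<in> Ob A; c \<in> Ob A\<rbrakk> \<Longrightarrow>
      (\<Sum>b\<in>Ob A. \<nu> (a, b) * of_nat (card (Hom A b c))) = (if a = c then 1 else 0)"
  shows "has_Moebius_inversion A" and "moebius A = \<nu>"
proof -
  interpret ring "RA A" using assms(1) by (rule ring_RA)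
  have z: "zeta A \<in> carrier (RA A)" and n: "\<nu> \<in> carrier (RA A)"
    using assms(2) by (auto simp: RA_def zeta_def PiE_def)
  have r: "zeta A \<otimes>\<^bsub>RA A\<^esub> \<nu> = \<one>\<^bsub>RA A\<^esub>" and l: "\<nu> \<otimes>\<^bsub>RA A\<^esub> zeta A = \<one>\<^bsub>RA A\<^esub>"
    by (auto simp: mult_RA one_RA zeta_def fun_eq_iff assms(3,4))
  show "has_Moebius_inversion A"
    unfolding has_Moebius_inversion_def Units_def using z n r l by blast
  show "moebius A = \<nu>"
    unfolding moebius_def using inv_unique'[OF z n r l] by simp
qed

lemma
  assumes "finite (Ob A)" "has_Moebius_inversion A" "a \<in> Ob A" "c \<in> Ob A"
  shows sum_zeta_moebius:
      "(\<Sum>b\<in>Ob A. of_nat (card (Hom A a b)) * moebius A (b, c)) = (if a = c then 1 else 0)"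
    and sum_moebius_zeta:
      "(\<Sum>b\<in>Ob A. moebius A (a, b) * of_nat (card (Hom A b c))) = (if a = c then 1 else 0)"
proof -
  interpret ring "RA A" using assms(1) by (rule ring_RA)
  have z: "zeta A \<in> Units (RA A)"
    using assms(2) by (simp add: has_Moebius_inversion_def)
  show "(\<Sum>b\<in>Ob A. of_nat (card (Hom A a b)) * moebius A (b, c)) = (if a = c then 1 else 0)"
    using fun_cong[OF Units_r_inv[OF z], of "(a, c)"] assms(3,4)
    by (simp add: mult_RA one_RA moebius_def zeta_def)
  show "(\<Sum>b\<in>Ob A. moebius A (a, b) * of_nat (card (Hom A b c))) = (if a = c then 1 else 0)"
    using fun_cong[OF Units_l_inv[OF z], of "(a, c)"] assms(3,4)
    by (simp add: mult_RA one_RA moebius_def zeta_def)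
qed

lemma row_sums_moebius_weighting:
  assumes "finite (Ob A)" "has_Moebius_inversion A"
  shows "weighting A (\<lambda>b. \<Sum>c\<in>Ob A. moebius A (b, c))"
  unfolding weighting_def
proof
  fix a assume a: "a \<in> Ob A"
  have "(\<Sum>b\<in>Ob A. of_nat (card (Hom A a b)) * (\<Sum>c\<in>Ob A. moebius A (b, c))) =
      (\<Sum>c\<in>Ob A. \<Sum>b\<in>Ob A. of_nat (card (Hom A a b)) * moebius A (b, c))"
    unfolding sum_distrib_left by (rule sum.swap)
  also have "\<dots> = (\<Sum>c\<in>Ob A. if a = c then 1 else 0)"
    by (rule sum.cong) (simp_all add: sum_zeta_moebius assms a)
  finally show "(\<Sum>b\<in>Ob A. of_nat (card (Hom A a b)) * (\<Sum>c\<in>Ob A. moebius A (b, c))) = 1"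
    using a assms(1) by simp
qed

lemma column_sums_moebius_coweighting:
  assumes "finite (Ob A)" "has_Moebius_inversion A"
  shows "coweighting A (\<lambda>b. \<Sum>a\<in>Ob A. moebius A (a, b))"
proof -
  have "(\<Sum>b\<in>Ob A. of_nat (card (Hom A b c)) * (\<Sum>a\<in>Ob A. moebius A (a, b))) = 1"
    if c: "c \<in> Ob A" for c
  proof -
    have "(\<Sum>b\<in>Ob A. of_nat (card (Hom A b c)) * (\<Sum>a\<in>Ob A. moebius A (a, b))) =
        (\<Sum>a\<in>Ob A. \<Sum>b\<in>Ob A. moebius A (a, b) * of_nat (card (Hom A b c)))"
      unfolding sum_distrib_left by (subst sum.swap) (simp add: mult.commute)
    also have "\<dots> = (\<Sum>a\<in>Ob A. if a = c then 1 else 0)"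
      by (rule sum.cong) (simp_all add: sum_moebius_zeta assms c)
    finally show ?thesis using c assms(1) by simp
  qed
  then show ?thesis by (simp add: coweighting_def weighting_def op_cat_def)
qed

lemma sum_Ob_adjoin:
  fixes f :: "'o adjoined \<Rightarrow> 'a :: comm_monoid_add"
  assumes "finite (Ob A)"
  shows "(\<Sum>x\<in>Ob (adjoin A). f x) = f Initial + (\<Sum>a\<in>Ob A. f (Base a)) + f Terminal"
proof -
  have "(\<Sum>x\<in>Base ` Ob A. f x) = (\<Sum>a\<in>Ob A. f (Base a))"
    by (subst sum.reindex) (auto simp: inj_on_def)
  moreover have "(\<Sum>x\<in>Ob (adjoin A). f x) = f Initial + (f Terminal + (\<Sum>x\<in>Base ` Ob A. f x))"
    unfolding adjoin_def using assms by (simp add: image_iff)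
  ultimately show ?thesis by (simp add: ac_simps)
qed

lemma card_Hom_adjoin:
  "card (Hom (adjoin A) Initial y) = 1"
  "card (Hom (adjoin A) x Terminal) = 1"
  "card (Hom (adjoin A) (Base a) Initial) = 0"
  "card (Hom (adjoin A) (Base a) (Base b)) = card (Hom A a b)"
  "card (Hom (adjoin A) Terminal Initial) = 0"
  "card (Hom (adjoin A) Terminal (Base b)) = 0"
  by (cases x; simp add: adjoin_def card_image)+

text \<open>The inverse block matrix found by back substitution.\<close>
fun adjoin_moebius :: "('o, 'm) cat \<Rightarrow> 'o adjoined \<times> 'o adjoined \<Rightarrow> rat" where
  "adjoin_moebius A (Initial, Initial) = 1"
| "adjoin_moebius A (Initial, Base c) = - (\<Sum>a\<in>Ob A. moebius A (a, c))"
| "adjoin_moebius A (Initial, Terminal) = (\<Sum>a\<in>Ob A. \<Sum>b\<in>Ob A. moebius A (a, b)) - 1"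
| "adjoin_moebius A (Base a, Initial) = 0"
| "adjoin_moebius A (Base a, Base c) = moebius A (a, c)"
| "adjoin_moebius A (Base a, Terminal) = - (\<Sum>b\<in>Ob A. moebius A (a, b))"
| "adjoin_moebius A (Terminal, Initial) = 0"
| "adjoin_moebius A (Terminal, Base c) = 0"
| "adjoin_moebius A (Terminal, Terminal) = 1"

lemma moebius_adjoin:
  assumes fin: "finite (Ob A)" and inv: "has_Moebius_inversion A"
  shows "has_Moebius_inversion (adjoin A)"
    and "moebius (adjoin A) = restrict (adjoin_moebius A) (Ob (adjoin A) \<times> Ob (adjoin A))"
proof -
  let ?O = "Ob (adjoin A)"
  let ?\<nu> = "restrict (adjoin_moebius A) (?O \<times> ?O)"
  have weight: "(\<Sum>b\<in>Ob A. of_nat (card (Hom A a b)) * (\<Sum>c\<in>Ob A. moebius A (b, c))) = 1"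
    if "a \<in> Ob A" for a
    using row_sums_moebius_weighting[OF assms] that by (simp add: weighting_def)
  have coweight: "(\<Sum>b\<in>Ob A. (\<Sum>a\<in>Ob A. moebius A (a, b)) * of_nat (card (Hom A b c))) = 1"
    if "c \<in> Ob A" for c
    using column_sums_moebius_coweighting[OF assms] that
    by (simp add: coweighting_def weighting_def op_cat_def mult.commute)
  \<comment> \<open>The corner of the inverse is written with row sums, but one product meets column sums.\<close>
  have total: "(\<Sum>b\<in>Ob A. \<Sum>a\<in>Ob A. moebius A (a, b)) = (\<Sum>a\<in>Ob A. \<Sum>b\<in>Ob A. moebius A (a, b))"
    by (rule sum.swap)
  have "(\<Sum>y\<in>?O. of_nat (card (Hom (adjoin A) x y)) * adjoin_moebius A (y, z)) =
      (if x = z then 1 else 0)" if "x \<in> ?O" "z \<in> ?O" for x z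
    using that unfolding sum_Ob_adjoin[OF fin]
    by (cases x; cases z)
      (auto simp: Ob_adjoin card_Hom_adjoin
        sum_zeta_moebius[OF assms] weight sum_negf)
  then have right: "(\<Sum>y\<in>?O. of_nat (card (Hom (adjoin A) x y)) * ?\<nu> (y, z)) =
      (if x = z then 1 else 0)" if "x \<in> ?O" "z \<in> ?O" for x z
    using that by simp
  have "(\<Sum>y\<in>?O. adjoin_moebius A (x, y) * of_nat (card (Hom (adjoin A) y z))) =
      (if x = z then 1 else 0)" if "x \<in> ?O" "z \<in> ?O" for x z
    using that unfolding sum_Ob_adjoin[OF fin]
    by (cases x; cases z)
      (auto simp: Ob_adjoin card_Hom_adjoin
        sum_moebius_zeta[OF assms] coweight sum_negf total)
  then have left: "(\<Sum>y\<in>?O. ?\<nu> (x, y) * of_nat (card (Hom (adjoin A) y z))) =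
      (if x = z then 1 else 0)" if "x \<in> ?O" "z \<in> ?O" for x z
    using that by simp
  have "finite ?O" using fin by (simp add: Ob_adjoin)
  note eqI = moebius_eqI[OF this restrict_extensional right left]
  show "has_Moebius_inversion (adjoin A)" by (rule eqI(1))
  show "moebius (adjoin A) = ?\<nu>" by (rule eqI(2))
qed

theorem proposition4p5:
  fixes A :: "('o, 'm) cat"
  assumes "finite_category A"
    and "has_Moebius_inversion A"
  shows "has_Moebius_inversion (adjoin A) \<and>
         moebius (adjoin A) (Initial, Terminal) = Euler_char A - 1"
proof -
  interpret finite_category A by fact
  note adj = moebius_adjoin[OF finite_Ob assms(2)]
  show ?thesis
    using adj(1) Moebius_inversion_imp_Euler_char(2)[OF finite_Ob assms(2)]
    by (simp add: adj(2) Ob_adjoin)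
qed

end
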